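(* Let $\mathfrak a_{n,m}$ be the number of $\sigma\in\mathcal{I}_n(120,201)$ with $\max(\sigma)=m$. Let $\mathfrak b_{n,k}$ be the number of words $\omega\in\mathcal W_{n,k+1}$ (words of length $n$ over $\{0,\dots,k\}$) avoiding $120$ such that $\omega_i<\omega_j\neq k$ implies $j<i$. Then for all integers $0<m<n$, $$\mathfrak a_{n,m}=\sum_{p=m+1}^{n}\sum_{j=0}^{m-1}\mathfrak a_{p-1,j}\,\mathfrak b_{n-p,m-j}.$$
   Context: For $n\in\mathbb N$, an inversion sequence of size $n$ is a sequence $\sigma=(\sigma_1,\dots,\sigma_n)\in\mathbb N^n$ with $\sigma_i<i$ for all $i$. An integer sequence contains a pattern $\rho$ (a finite integer sequence such as $120$ or $201$) if it has a subsequence order-isomorphic to $\rho$, and avoids $\rho$ otherwise. $\mathcal{I}_n(P)$ denotes the set of inversion sequences of size $n$ avoiding every pattern in the set $P$. $\mathcal W_{n,k}=\{0,\dots,k-1\}^n$ is the set of words of length $n$ over the alphabet $\{0,\dots,k-1\}$. $\max(\sigma)$ is the largest entry of $\sigma$. *)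

theory Defs
  imports Main "HOL-Library.Sublist"
begin

definition order_isomorphic :: "'a::linorder list \<Rightarrow> 'b::linorder list \<Rightarrow> bool" where
  "order_isomorphic xs ys \<longleftrightarrow>
     length xs = length ys \<and>
     (\<forall>i<length xs. \<forall>j<length xs. xs ! i < xs ! j \<longleftrightarrow> ys ! i < ys ! j)"

definition contains_pattern :: "'a::linorder list \<Rightarrow> 'b::linorder list \<Rightarrow> bool" where
  "contains_pattern \<sigma> \<rho> \<longleftrightarrow> (\<exists>\<tau>. subseq \<tau> \<sigma> \<and> order_isomorphic \<tau> \<rho>)"

abbreviation avoids :: "'a::linorder list \<Rightarrow> 'b::linorder list \<Rightarrow> bool" where
  "avoids \<sigma> \<rho> \<equiv> \<not> contains_pattern \<sigma> \<rho>"

(* Lists are indexed from 0, so the entry sigma_i of the 1-based sequence is \<sigma> ! (i - 1). *)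
definition inversion_sequences :: "nat \<Rightarrow> nat list set" where
  "inversion_sequences n = {\<sigma>. length \<sigma> = n \<and> (\<forall>i\<in>{1..n}. \<sigma> ! (i - 1) < i)}"

definition inversion_sequences_avoiding :: "nat \<Rightarrow> nat list set \<Rightarrow> nat list set" where
  "inversion_sequences_avoiding n P =
     {\<sigma> \<in> inversion_sequences n. \<forall>\<rho>\<in>P. avoids \<sigma> \<rho>}"

definition words :: "nat \<Rightarrow> nat \<Rightarrow> nat list set" where
  "words n k = {\<omega>. length \<omega> = n \<and> set \<omega> \<subseteq> {0..<k}}"

(* Meaningful for n > 0 only: for n = 0 it involves the unspecified value Max {}. *)
definition a_count :: "nat \<Rightarrow> nat \<Rightarrow> nat" where
  "a_count n m =
     card {\<sigma> \<in> inversion_sequences_avoiding n {[1, 2, 0], [2, 0, 1]}. Max (set \<sigma>) = m}"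

definition b_count :: "nat \<Rightarrow> nat \<Rightarrow> nat" where
  "b_count n k =
     card {\<omega> \<in> words n (k + 1). avoids \<omega> [1, 2, 0 :: nat] \<and>
             (\<forall>i<n. \<forall>j<n. \<omega> ! i < \<omega> ! j \<and> \<omega> ! j \<noteq> k \<longrightarrow> j < i)}"

end

theory Submission
  imports Defs
begin

text \<open>
  Split \<open>\<sigma>\<close> at its first maximum: \<open>\<sigma> = \<alpha> @ m # \<beta>\<close>, and let \<open>j = Max (set \<alpha>)\<close>, \<open>p = length \<alpha> + 1\<close>.
  Avoiding 120 forces every entry of \<open>\<beta>\<close> to be at least \<open>j\<close> (otherwise \<open>j, m\<close> and that entry form
  a 120), and avoiding 201 forces an ascent pair of \<open>\<beta>\<close> to end in \<open>m\<close> (otherwise it forms a 201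
  with the first maximum). Conversely, under these two conditions no occurrence of either pattern
  uses both \<open>\<alpha>\<close> and \<open>m # \<beta>\<close>. Being an inversion sequence constrains \<open>\<beta>\<close> no further, since
  \<open>p > m\<close>. Subtracting \<open>j\<close> from \<open>\<beta>\<close> gives the words counted by \<open>b_count\<close>.
\<close>

section \<open>Occurrences of short patterns as subsequences\<close>

text \<open>Links the index condition in \<open>b_count\<close> with the subsequence language used
  for patterns.\<close>

lemma subseq_pair_iff_nth:
  "subseq [x, y] zs \<longleftrightarrow> (\<exists>i j. i < j \<and> j < length zs \<and> zs ! i = x \<and> zs ! j = y)"
proof (induction zs)
  case (Cons z zs)
  show ?case
  proof (cases "z = x")
    case True
    \<comment> \<open>Greedy matching: when the head is \<open>x\<close>, it can replace any later
      occurrence of \<open>x\<close>, so all that matters is a \<open>y\<close> in the tail.\<close>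
    have "(\<exists>i j. i < j \<and> j < length (z # zs) \<and> (z # zs) ! i = x \<and> (z # zs) ! j = y) \<longleftrightarrow> y \<in> set zs"
      (is "?L \<longleftrightarrow> _")
    proof
      assume ?L
      then obtain i j where "i < j" "j < length (z # zs)" "(z # zs) ! j = y" by blast
      then show "y \<in> set zs" by (cases j) auto
    next
      assume "y \<in> set zs"
      then obtain j where "j < length zs" "zs ! j = y" by (auto simp: in_set_conv_nth)
      then show ?L using True by (intro exI[of _ 0] exI[of _ "Suc j"]) auto
    qed
    then show ?thesis using True by (simp add: subseq_singleton_left)
  next
    case False
    have "(\<exists>i j. i < j \<and> j < length (z # zs) \<and> (z # zs) ! i = x \<and> (z # zs) ! j = y) \<longleftrightarrow>
      (\<exists>i j. i < j \<and> j < length zs \<and> zs ! i = x \<and> zs ! j = y)" (is "?L \<longleftrightarrow> ?R")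
    proof
      assume ?L
      then obtain i j where ij: "i < j" "j < length (z # zs)" "(z # zs) ! i = x" "(z # zs) ! j = y"
        by blast
      with False obtain i' where "i = Suc i'" by (cases i) auto
      with ij show ?R by (intro exI[of _ i'] exI[of _ "j - 1"]) auto
    next
      assume ?R
      then obtain i j where "i < j" "j < length zs" "zs ! i = x" "zs ! j = y" by blast
      then show ?L by (intro exI[of _ "Suc i"] exI[of _ "Suc j"]) auto
    qed
    then show ?thesis using False Cons.IH by simp
  qed
qed simp

text \<open>The comparisons between values adjacent in the pattern decide all the others by
  transitivity; the same holds for 201 below.\<close>

lemma order_isomorphic_120_iff:
  "order_isomorphic \<tau> [1, 2, 0 :: nat] \<longleftrightarrow> (\<exists>a b c. \<tau> = [a, b, c] \<and> c < a \<and> a < b)"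
proof -
  have "order_isomorphic [a, b, c] [1, 2, 0 :: nat] \<longleftrightarrow> c < a \<and> a < b" for a b c :: 'a
    by (auto simp: order_isomorphic_def less_Suc_eq all_conj_distrib)
  moreover have "\<exists>a b c. \<tau> = [a, b, c]" if "order_isomorphic \<tau> [1, 2, 0 :: nat]"
    using that by (auto simp: order_isomorphic_def length_Suc_conv)
  ultimately show ?thesis by blast
qed

lemma order_isomorphic_201_iff:
  "order_isomorphic \<tau> [2, 0, 1 :: nat] \<longleftrightarrow> (\<exists>a b c. \<tau> = [a, b, c] \<and> b < c \<and> c < a)"
proof -
  have "order_isomorphic [a, b, c] [2, 0, 1 :: nat] \<longleftrightarrow> b < c \<and> c < a" for a b c :: 'a
    by (auto simp: order_isomorphic_def less_Suc_eq all_conj_distrib)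
  moreover have "\<exists>a b c. \<tau> = [a, b, c]" if "order_isomorphic \<tau> [2, 0, 1 :: nat]"
    using that by (auto simp: order_isomorphic_def length_Suc_conv)
  ultimately show ?thesis by blast
qed

lemma contains_120_iff:
  "contains_pattern \<sigma> [1, 2, 0 :: nat] \<longleftrightarrow> (\<exists>a b c. subseq [a, b, c] \<sigma> \<and> c < a \<and> a < b)"
  unfolding contains_pattern_def order_isomorphic_120_iff by blast

lemma contains_201_iff:
  "contains_pattern \<sigma> [2, 0, 1 :: nat] \<longleftrightarrow> (\<exists>a b c. subseq [a, b, c] \<sigma> \<and> b < c \<and> c < a)"
  unfolding contains_pattern_def order_isomorphic_201_iff by blast

text \<open>Cut the triple into a part embedded in \<open>xs\<close> and a part embedded in
  \<open>y # zs\<close>; the cases record the cut and whether \<open>y\<close> is used. Straddling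
  cases keep little more than membership, which suffices to exclude occurrences across the first
  maximum.\<close>

lemma subseq_triple_append_Cons_cases:
  assumes "subseq [a, b, c] (xs @ y # zs)"
  obtains "subseq [a, b, c] xs" | "a \<in> set xs" "b \<in> set xs" "c = y"
    | "a \<in> set xs" "b \<in> set xs" "c \<in> set zs" | "a \<in> set xs" "b = y" "c \<in> set zs"
    | "a \<in> set xs" "subseq [b, c] zs" | "a = y" "subseq [b, c] zs" | "subseq [a, b, c] zs"
proof -
  have mem: "u \<in> set ws \<and> v \<in> set ws" if "subseq [u, v] ws" for u v and ws :: "'a list"
    using that by (auto simp: subseq_pair_iff_nth)
  obtain us vs where uv: "[a, b, c] = us @ vs" "subseq us xs" "subseq vs (y # zs)"
    using assms unfolding subseq_append_iff by blast
  from uv(1) consider "us = []" "vs = [a, b, c]" | "us = [a]" "vs = [b, c]"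
    | "us = [a, b]" "vs = [c]" | "us = [a, b, c]"
    unfolding Cons_eq_append_conv by auto
  then show thesis
  proof cases
    case 1
    then have "a = y \<and> subseq [b, c] zs \<or> subseq [a, b, c] zs"
      using uv(3) by (simp split: if_splits)
    then show thesis using that(6,7) by blast
  next
    case 2
    then have "a \<in> set xs" "subseq [b, c] (y # zs)"
      using uv(2,3) by (simp_all add: subseq_singleton_left)
    then have "b = y \<and> c \<in> set zs \<or> subseq [b, c] zs"
      by (simp add: subseq_singleton_left split: if_splits)
    then show thesis using that(4,5) \<open>a \<in> set xs\<close> by blast
  next
    case 3
    then have "a \<in> set xs" "b \<in> set xs" "c = y \<or> c \<in> set zs"
      using uv(2,3) mem[of a b xs] by (auto simp: subseq_singleton_left split: if_splits)
    then show thesis using that(2,3) by blast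
  next
    case 4
    then show thesis using uv that(1) by blast
  qed
qed

lemma contains_pattern_subseq:
  assumes "contains_pattern xs \<rho>" and "subseq xs ys"
  shows "contains_pattern ys \<rho>"
  using assms unfolding contains_pattern_def by (meson subseq_order.order_trans)

lemma subseq_map_right_iff: "subseq ys (map f xs) \<longleftrightarrow> (\<exists>zs. subseq zs xs \<and> ys = map f zs)"
  unfolding subseq_conv_nths by (auto simp: nths_map)

text \<open>Such maps preserve and reflect \<open><\<close>, which is all that order isomorphism
  sees. The intended map is the shift \<open>(+) j\<close>.\<close>

lemma contains_pattern_map_strict_mono:
  assumes "strict_mono f"
  shows "contains_pattern (map f xs) \<rho> \<longleftrightarrow> contains_pattern xs \<rho>"
proof -
  have "order_isomorphic (map f \<tau>) \<rho> \<longleftrightarrow> order_isomorphic \<tau> \<rho>" for \<tau>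
    by (auto simp: order_isomorphic_def strict_mono_less[OF assms])
  then show ?thesis
    unfolding contains_pattern_def subseq_map_right_iff by blast
qed

section \<open>Avoidance across the first maximum\<close>

lemma avoids_120_201_append_max_iff:
  fixes \<alpha> \<beta> :: "'a::linorder list"
  assumes "\<alpha> \<noteq> []" and "\<forall>x\<in>set \<alpha>. x < m" and "\<forall>x\<in>set \<beta>. x \<le> m"
  shows "avoids (\<alpha> @ m # \<beta>) [1, 2, 0 :: nat] \<and> avoids (\<alpha> @ m # \<beta>) [2, 0, 1 :: nat] \<longleftrightarrow>
    avoids \<alpha> [1, 2, 0 :: nat] \<and> avoids \<alpha> [2, 0, 1 :: nat] \<and> avoids \<beta> [1, 2, 0 :: nat] \<and>
    (\<forall>x\<in>set \<beta>. Max (set \<alpha>) \<le> x) \<and> (\<forall>y z. subseq [y, z] \<beta> \<and> y < z \<longrightarrow> z = m)"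
    (is "?L \<longleftrightarrow> ?R")
proof
  note \<alpha> = assms(2)[rule_format] and \<beta> = assms(3)[rule_format]
  assume L: ?L
  have "subseq \<alpha> (\<alpha> @ m # \<beta>)" by (simp add: subseq_rev_drop_many)
  moreover have "subseq \<beta> (\<alpha> @ m # \<beta>)" by (simp add: subseq_drop_many list_emb_Cons)
  moreover have "Max (set \<alpha>) \<le> x" if "x \<in> set \<beta>" for x
  proof (rule ccontr)
    assume "\<not> Max (set \<alpha>) \<le> x"
    have "Max (set \<alpha>) \<in> set \<alpha>" using assms(1) by simp
    \<comment> \<open>One letter comes from \<alpha> and two from \<open>m # \<beta>\<close>; since
      \<open>x < Max (set \<alpha>) < m\<close>, this is a 120.\<close>
    have "subseq ([Max (set \<alpha>)] @ [m, x]) (\<alpha> @ m # \<beta>)"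
      using \<open>Max (set \<alpha>) \<in> set \<alpha>\<close> that
      by (intro list_emb_append_mono) (auto simp: subseq_singleton_left)
    then have "subseq [Max (set \<alpha>), m, x] (\<alpha> @ m # \<beta>)" by simp
    then show False
      using L \<open>\<not> Max (set \<alpha>) \<le> x\<close> \<alpha>[OF \<open>Max (set \<alpha>) \<in> set \<alpha>\<close>]
      unfolding contains_120_iff by (meson not_le)
  qed
  moreover have "z = m" if "subseq [y, z] \<beta>" "y < z" for y z
  proof (rule ccontr)
    assume "z \<noteq> m"
    have "z \<in> set \<beta>" using that(1) by (auto simp: subseq_pair_iff_nth)
    then have "z < m" using \<beta> \<open>z \<noteq> m\<close> by (simp add: order.not_eq_order_implies_strict)
    \<comment> \<open>The displayed \<open>m\<close> precedes all of \<beta>, so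
      \<open>y < z < m\<close> gives a 201.\<close>
    moreover have "subseq [m, y, z] (\<alpha> @ m # \<beta>)"
      using that(1) by (simp add: subseq_drop_many)
    ultimately show False
      using L that(2) unfolding contains_201_iff by blast
  qed
  ultimately show ?R using L contains_pattern_subseq by blast
next
  note \<alpha> = assms(2)[rule_format] and \<beta> = assms(3)[rule_format]
  assume R: ?R
  have le: "x \<le> z" if "x \<in> set \<alpha>" "z \<in> set \<beta>" for x z
    using R that by (meson List.finite_set Max_ge order_trans)
  have mem: "u \<in> set \<beta> \<and> v \<in> set \<beta>" if "subseq [u, v] \<beta>" for u v
    using that by (auto simp: subseq_pair_iff_nth)
  have tail: "subseq [b, c] \<beta>" if "subseq [a, b, c] \<beta>" for a b c
    using that by (rule subseq_Cons')
  \<comment> \<open>For a straddling 120: if \<open>a\<close> is in \<alpha> and \<open>c\<close> in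
    \<beta>, then \<open>le\<close> contradicts \<open>c < a\<close>; if \<open>c = m\<close>, then
    \<open>a\<close> in \<alpha> would exceed \<open>m\<close>; if \<open>a = m\<close>, then
    \<open>b\<close> in \<beta> would exceed \<open>m\<close>.\<close>
  have "avoids (\<alpha> @ m # \<beta>) [1, 2, 0 :: nat]"
    unfolding contains_120_iff
  proof safe
    fix a b c assume "subseq [a, b, c] (\<alpha> @ m # \<beta>)" and o: "c < a" "a < b"
    then show False
    proof (cases rule: subseq_triple_append_Cons_cases)
      case 1 then show False using R o unfolding contains_120_iff by blast
    next
      case 2 then show False using \<alpha> o by fastforce
    next
      case 3 then show False using le o by fastforce
    next
      case 4 then show False using le o by fastforce
    next
      case 5 then show False using le mem o by fastforce
    next
      case 6 then show False using \<beta> mem o by fastforce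
    next
      case 7 then show False using R o unfolding contains_120_iff by blast
    qed
  qed
  \<comment> \<open>For a 201 the first two exclusions are the same. If \<open>a = m\<close>, the
    ascent \<open>b < c\<close> in \<beta> forces \<open>c = m\<close>, against
    \<open>c < a\<close>.\<close>
  moreover have "avoids (\<alpha> @ m # \<beta>) [2, 0, 1 :: nat]"
    unfolding contains_201_iff
  proof safe
    fix a b c assume "subseq [a, b, c] (\<alpha> @ m # \<beta>)" and o: "b < c" "c < a"
    then show False
    proof (cases rule: subseq_triple_append_Cons_cases)
      case 1 then show False using R o unfolding contains_201_iff by blast
    next
      case 2 then show False using \<alpha> o by fastforce
    next
      case 3 then show False using le o by fastforce
    next
      case 4 then show False using le o by fastforce
    next
      case 5 then show False using le mem o by fastforce
    next
      case 6 then show False using R o by blast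
    next
      case 7
      \<comment> \<open>A 201 inside \<beta> is excluded by the ascent condition: its last letter
        would be \<open>m\<close>, and its first letter would be larger still.\<close>
      then have "c = m" using R o tail by blast
      moreover have "a \<in> set \<beta>" using list_emb_set[OF 7, of a] by auto
      ultimately have "m < a" "a \<le> m" using \<beta> o by auto
      then show False by simp
    qed
  qed
  ultimately show ?L by blast
qed

section \<open>The counted families as sets\<close>

definition a_seqs :: "nat \<Rightarrow> nat \<Rightarrow> nat list set" where
  "a_seqs n m = {\<sigma> \<in> inversion_sequences_avoiding n {[1, 2, 0], [2, 0, 1]}. Max (set \<sigma>) = m}"

definition b_words :: "nat \<Rightarrow> nat \<Rightarrow> nat list set" where
  "b_words n k = {\<omega> \<in> words n (k + 1). avoids \<omega> [1, 2, 0 :: nat] \<and>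
     (\<forall>i<n. \<forall>j<n. \<omega> ! i < \<omega> ! j \<and> \<omega> ! j \<noteq> k \<longrightarrow> j < i)}"

lemma a_count_eq_card: "a_count n m = card (a_seqs n m)"
  unfolding a_count_def a_seqs_def ..

lemma b_count_eq_card: "b_count n k = card (b_words n k)"
  unfolding b_count_def b_words_def ..

lemma inversion_sequences_iff:
  "\<sigma> \<in> inversion_sequences n \<longleftrightarrow> length \<sigma> = n \<and> (\<forall>i<n. \<sigma> ! i \<le> i)"
proof -
  have "(\<forall>i\<in>{1..n}. \<sigma> ! (i - 1) < i) \<longleftrightarrow> (\<forall>i<n. \<sigma> ! i \<le> i)"
  proof safe
    fix i assume "\<forall>i\<in>{1..n}. \<sigma> ! (i - 1) < i" "i < n"
    then show "\<sigma> ! i \<le> i" by (auto dest: bspec[of _ _ "Suc i"])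
  next
    fix i assume "\<forall>i<n. \<sigma> ! i \<le> i" "i \<in> {1..n}"
    then show "\<sigma> ! (i - 1) < i" by (auto dest: spec[of _ "i - 1"])
  qed
  then show ?thesis by (simp add: inversion_sequences_def)
qed

lemma a_seqs_iff:
  "\<sigma> \<in> a_seqs n m \<longleftrightarrow> length \<sigma> = n \<and> (\<forall>i<n. \<sigma> ! i \<le> i) \<and>
    avoids \<sigma> [1, 2, 0 :: nat] \<and> avoids \<sigma> [2, 0, 1 :: nat] \<and> Max (set \<sigma>) = m"
  by (simp add: a_seqs_def inversion_sequences_avoiding_def inversion_sequences_iff)

text \<open>Contraposition: two positions with different entries are distinct, so failure of
  \<open>j < i\<close> means \<open>i < j\<close>, an ascending pair. This is the form in which the
  condition on the tail \<beta> arises.\<close>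

lemma b_words_iff:
  "\<omega> \<in> b_words n k \<longleftrightarrow> length \<omega> = n \<and> (\<forall>x\<in>set \<omega>. x \<le> k) \<and> avoids \<omega> [1, 2, 0 :: nat] \<and>
    (\<forall>y z. subseq [y, z] \<omega> \<and> y < z \<longrightarrow> z = k)"
proof -
  have "(\<forall>i<length \<omega>. \<forall>j<length \<omega>. \<omega> ! i < \<omega> ! j \<and> \<omega> ! j \<noteq> k \<longrightarrow> j < i) \<longleftrightarrow>
    (\<forall>y z. subseq [y, z] \<omega> \<and> y < z \<longrightarrow> z = k)"
    (is "?L \<longleftrightarrow> ?R")
  proof
    assume L: ?L
    have "z = k" if "subseq [y, z] \<omega>" "y < z" for y z
    proof -
      obtain i j where "i < j" "j < length \<omega>" "\<omega> ! i = y" "\<omega> ! j = z"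
        using \<open>subseq [y, z] \<omega>\<close> unfolding subseq_pair_iff_nth by blast
      then show ?thesis using L[rule_format, of i j] \<open>y < z\<close> by auto
    qed
    then show ?R by blast
  next
    assume R: ?R
    show ?L
    proof (intro allI impI)
      fix i j assume *: "i < length \<omega>" "j < length \<omega>" "\<omega> ! i < \<omega> ! j \<and> \<omega> ! j \<noteq> k"
      then have "\<not> i < j" using R unfolding subseq_pair_iff_nth by blast
      moreover have "i \<noteq> j" using * by auto
      ultimately show "j < i" by simp
    qed
  qed
  moreover have "\<omega> \<in> words n (k + 1) \<longleftrightarrow> length \<omega> = n \<and> (\<forall>x\<in>set \<omega>. x \<le> k)"
    by (auto simp: words_def)
  ultimately show ?thesis unfolding b_words_def mem_Collect_eq by metis
qed

lemma finite_a_seqs: "finite (a_seqs n m)"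
proof (rule finite_subset)
  show "a_seqs n m \<subseteq> {\<sigma>. set \<sigma> \<subseteq> {..<n} \<and> length \<sigma> = n}"
  proof safe
    fix \<sigma> x assume "\<sigma> \<in> a_seqs n m" "x \<in> set \<sigma>"
    then show "x < n" unfolding a_seqs_iff in_set_conv_nth by (auto intro: le_less_trans)
  qed (simp add: a_seqs_iff)
qed (simp add: finite_lists_length_eq)

lemma finite_b_words: "finite (b_words n k)"
proof (rule finite_subset)
  show "b_words n k \<subseteq> {\<omega>. set \<omega> \<subseteq> {..k} \<and> length \<omega> = n}"
    by (auto simp: b_words_iff)
qed (simp add: finite_lists_length_eq)

text \<open>Every condition on \<open>b_words\<close> is translation invariant once \<open>k\<close>
  moves to \<open>j + k\<close>. Stated on the shifted word, it matches the conditions on \<beta>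
  with \<open>m = j + k\<close>.\<close>

lemma map_add_in_b_words_iff:
  fixes j k :: nat
  shows "\<omega> \<in> b_words n k \<longleftrightarrow> length \<omega> = n \<and> (\<forall>x\<in>set (map ((+) j) \<omega>). x \<le> j + k) \<and>
    avoids (map ((+) j) \<omega>) [1, 2, 0 :: nat] \<and>
    (\<forall>y z. subseq [y, z] (map ((+) j) \<omega>) \<and> y < z \<longrightarrow> z = j + k)"
proof -
  have "strict_mono ((+) j)" by (simp add: strict_mono_def)
  moreover have "(\<forall>y z. subseq [y, z] (map ((+) j) \<omega>) \<and> y < z \<longrightarrow> z = j + k) \<longleftrightarrow>
    (\<forall>y z. subseq [y, z] \<omega> \<and> y < z \<longrightarrow> z = k)"
    (is "?L \<longleftrightarrow> ?R")
  proof
    assume L: ?L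
    have "z = k" if "subseq [y, z] \<omega>" "y < z" for y z
      using L[rule_format, of "j + y" "j + z"] subseq_map[OF that(1), of "(+) j"] that(2) by simp
    then show ?R by blast
  qed (auto simp: subseq_map_right_iff)
  ultimately show ?thesis
    by (simp add: b_words_iff contains_pattern_map_strict_mono)
qed

section \<open>The decomposition at the first maximum\<close>

text \<open>Combines the avoidance criterion with the inversion bound, so that membership splits
  into independent conditions on \<alpha> and \<omega>. The conjunct
  \<open>length \<alpha> < n\<close> keeps \<open>n - Suc (length \<alpha>)\<close> from being
  truncated.\<close>

lemma append_max_in_a_seqs_iff:
  assumes "\<alpha> \<noteq> []" and "j < m" and j: "Max (set \<alpha>) = j" and k: "m = j + k"
  shows "\<alpha> @ m # map ((+) j) \<omega> \<in> a_seqs n m \<longleftrightarrow>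
    m \<le> length \<alpha> \<and> length \<alpha> < n \<and> \<alpha> \<in> a_seqs (length \<alpha>) j \<and> \<omega> \<in> b_words (n - Suc (length \<alpha>)) k"
    (is "?\<sigma> \<in> _ \<longleftrightarrow> _")
\<comment> \<open>Each side implies this length equation and upper bound, so outside this case both
  sides are false.\<close>
proof (cases "(\<forall>x\<in>set (map ((+) j) \<omega>). x \<le> m) \<and> n = Suc (length \<alpha> + length \<omega>)")
  case True
  then have \<beta>: "\<And>x. x \<in> set (map ((+) j) \<omega>) \<Longrightarrow> x \<le> m" by blast
  have \<alpha>: "x < m" if "x \<in> set \<alpha>" for x
    using that j \<open>j < m\<close> Max_ge[of "set \<alpha>" x] by simp
  have "Max (set ?\<sigma>) = m"
    using \<alpha> \<beta> by (intro Max_eqI) (auto intro: less_imp_le)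
  \<comment> \<open>The displayed \<open>m\<close> sits at index \<open>length \<alpha>\<close>,
    which gives \<open>m \<le> length \<alpha>\<close>. Conversely, later entries are at most
    \<open>m\<close>, hence below their own index.\<close>
  moreover have "(\<forall>i<n. ?\<sigma> ! i \<le> i) \<longleftrightarrow> m \<le> length \<alpha> \<and> (\<forall>i<length \<alpha>. \<alpha> ! i \<le> i)"
  proof safe
    assume *: "\<forall>i<n. ?\<sigma> ! i \<le> i"
    show "m \<le> length \<alpha>" using *[rule_format, of "length \<alpha>"] True by simp
    show "\<alpha> ! i \<le> i" if "i < length \<alpha>" for i
      using *[rule_format, of i] True that by (simp add: nth_append)
  next
    fix i assume *: "m \<le> length \<alpha>" "\<forall>i<length \<alpha>. \<alpha> ! i \<le> i" "i < n"
    show "?\<sigma> ! i \<le> i"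
    proof (cases "i < length \<alpha>")
      case False
      have "?\<sigma> ! i \<in> set (m # map ((+) j) \<omega>)"
        using False *(3) True nth_mem[of "i - length \<alpha>" "m # map ((+) j) \<omega>"]
        unfolding nth_append by auto
      then have "?\<sigma> ! i \<le> m" using \<beta> by auto
      then show ?thesis using False *(1) by linarith
    qed (use * in \<open>simp add: nth_append\<close>)
  qed
  \<comment> \<open>The shift by \<open>j\<close> builds the lower bound on the tail into the
    construction.\<close>
  moreover have "\<forall>x\<in>set (map ((+) j) \<omega>). Max (set \<alpha>) \<le> x" using j by auto
  moreover have "length ?\<sigma> = n" "length \<alpha> < n" "length \<omega> = n - Suc (length \<alpha>)"
    using True by simp_all
  moreover have "avoids ?\<sigma> [1, 2, 0 :: nat] \<and> avoids ?\<sigma> [2, 0, 1 :: nat] \<longleftrightarrow>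
    avoids \<alpha> [1, 2, 0 :: nat] \<and> avoids \<alpha> [2, 0, 1 :: nat] \<and>
    avoids (map ((+) j) \<omega>) [1, 2, 0 :: nat] \<and> (\<forall>x\<in>set (map ((+) j) \<omega>). Max (set \<alpha>) \<le> x) \<and>
    (\<forall>y z. subseq [y, z] (map ((+) j) \<omega>) \<and> y < z \<longrightarrow> z = m)"
    using assms(1) \<alpha> \<beta> by (intro avoids_120_201_append_max_iff ballI)
  ultimately show ?thesis
    using True j unfolding a_seqs_iff map_add_in_b_words_iff[of \<omega> _ k j] k[symmetric] by metis
next
  case False
  have "?\<sigma> \<notin> a_seqs n m"
  proof
    assume \<sigma>: "?\<sigma> \<in> a_seqs n m"
    have "x \<le> m" if "x \<in> set (map ((+) j) \<omega>)" for x
      using \<sigma> that Max_ge[of "set ?\<sigma>" x] unfolding a_seqs_iff by auto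
    moreover have "n = Suc (length \<alpha> + length \<omega>)" using \<sigma> unfolding a_seqs_iff by simp
    ultimately show False using False by blast
  qed
  moreover have "\<omega> \<notin> b_words (n - Suc (length \<alpha>)) k" if "length \<alpha> < n"
  proof
    assume "\<omega> \<in> b_words (n - Suc (length \<alpha>)) k"
    then have "length \<omega> = n - Suc (length \<alpha>)" "\<forall>x\<in>set (map ((+) j) \<omega>). x \<le> m"
      unfolding map_add_in_b_words_iff[of \<omega> _ k j] k by blast+
    then show False using False that by simp
  qed
  ultimately show ?thesis by blast
qed

text \<open>The inverse cuts at the first \<open>m\<close>: \<alpha> is what precedes it,
  \<open>p\<close> and \<open>j\<close> are read off from \<alpha>, and \<omega> is the remainder
  lowered by \<open>j\<close>. The range of \<open>p\<close> starts at \<open>m + 1\<close> because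
  \<open>p - 1 = length \<alpha>\<close> is at least \<open>m\<close>.\<close>

lemma bij_betw_append_max_a_seqs:
  assumes "0 < m" and "m < n"
  shows "bij_betw (\<lambda>(p, j, \<alpha>, \<omega>). \<alpha> @ m # map ((+) j) \<omega>)
    (SIGMA p : {m + 1..n}. SIGMA j : {0..m - 1}. a_seqs (p - 1) j \<times> b_words (n - p) (m - j))
    (a_seqs n m)" (is "bij_betw ?f ?D _")
  unfolding bij_betw_def
proof
  \<comment> \<open>Since \<open>p - 1 \<ge> m > 0\<close>, \<alpha> is nonempty and its
    \<open>Max\<close> is a genuine entry; being \<open>j < m\<close>, it keeps \<open>m\<close> out
    of \<alpha>.\<close>
  have D: "p = Suc (length \<alpha>) \<and> m \<le> length \<alpha> \<and> length \<alpha> < n \<and> \<alpha> \<noteq> [] \<and>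
      Max (set \<alpha>) = j \<and> j < m \<and> m \<notin> set \<alpha> \<and>
      \<alpha> \<in> a_seqs (length \<alpha>) j \<and> \<omega> \<in> b_words (n - Suc (length \<alpha>)) (m - j)"
    if "(p, j, \<alpha>, \<omega>) \<in> ?D" for p j \<alpha> \<omega>
  proof -
    have len: "length \<alpha> = p - 1" and max: "Max (set \<alpha>) = j" and "m + 1 \<le> p" "p \<le> n" "j < m"
      using that assms by (auto simp: a_seqs_iff)
    moreover from this have "m \<notin> set \<alpha>" using Max_ge[of "set \<alpha>" m] by auto
    moreover have "p = Suc (length \<alpha>)" using len \<open>m + 1 \<le> p\<close> by simp
    ultimately show ?thesis using that assms by auto
  qed
  show "inj_on ?f ?D"
  proof (rule inj_onI)
    fix u v assume uv: "u \<in> ?D" "v \<in> ?D" "?f u = ?f v"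
    obtain p j \<alpha> \<omega> p' j' \<alpha>' \<omega>' where u: "u = (p, j, \<alpha>, \<omega>)" and v: "v = (p', j', \<alpha>', \<omega>')"
      by (metis prod_cases4)
    have eq: "\<alpha> @ m # map ((+) j) \<omega> = \<alpha>' @ m # map ((+) j') \<omega>'" using uv(3) u v by simp
    have Du: "m \<notin> set \<alpha>" "p = Suc (length \<alpha>)" "j = Max (set \<alpha>)"
      using D uv(1) unfolding u by blast+
    have Dv: "m \<notin> set \<alpha>'" "p' = Suc (length \<alpha>')" "j' = Max (set \<alpha>')"
      using D uv(2) unfolding v by blast+
    \<comment> \<open>Recovers the prefix from the whole list, because the displayed
      \<open>m\<close> is its first occurrence.\<close>
    have "takeWhile (\<lambda>x. x \<noteq> m) (\<gamma> @ m # \<delta>) = \<gamma>" if "m \<notin> set \<gamma>" for \<gamma> \<delta>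
      using that by (subst takeWhile_append2) auto
    from this[of \<alpha> "map ((+) j) \<omega>"] this[of \<alpha>' "map ((+) j') \<omega>'"] have "\<alpha> = \<alpha>'"
      using Du(1) Dv(1) eq by simp
    moreover from this have "j = j'" "p = p'" using Du(2,3) Dv(2,3) by simp_all
    moreover have "\<omega> = \<omega>'"
      using eq \<open>\<alpha> = \<alpha>'\<close> \<open>j = j'\<close> by (simp add: inj_map_eq_map)
    ultimately show "u = v" using u v by simp
  qed
  show "?f ` ?D = a_seqs n m"
  proof (intro equalityI subsetI)
    fix \<sigma> assume "\<sigma> \<in> ?f ` ?D"
    then obtain p j \<alpha> \<omega> where d: "(p, j, \<alpha>, \<omega>) \<in> ?D" and \<sigma>: "\<sigma> = \<alpha> @ m # map ((+) j) \<omega>"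
      by force
    show "\<sigma> \<in> a_seqs n m"
      unfolding \<sigma> using D[OF d] append_max_in_a_seqs_iff[of \<alpha> j m "m - j" \<omega> n]
      by (metis le_add_diff_inverse less_imp_le)
  next
    fix \<sigma> assume \<sigma>: "\<sigma> \<in> a_seqs n m"
    have "\<sigma> \<noteq> []" using \<sigma> assms by (auto simp: a_seqs_iff)
    then have "m \<in> set \<sigma>" using \<sigma> Max_in[of "set \<sigma>"] by (auto simp: a_seqs_iff)
    then obtain \<alpha> \<beta> where split: "\<sigma> = \<alpha> @ m # \<beta>" "m \<notin> set \<alpha>" by (meson split_list_first)
    have le: "x \<le> m" if "x \<in> set \<sigma>" for x
      using \<sigma> that Max_ge[of "set \<sigma>" x] by (auto simp: a_seqs_iff)
    have \<alpha>: "x < m" if "x \<in> set \<alpha>" for x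
      using le[of x] that split by (cases "x = m") auto
    have \<beta>: "x \<le> m" if "x \<in> set \<beta>" for x
      using le[of x] that split(1) by simp
    \<comment> \<open>The inversion bound at the index of the first \<open>m\<close>; with
      \<open>0 < m\<close> it makes \<alpha> nonempty, so that \<open>j\<close> below is well
      determined.\<close>
    have "m \<le> length \<alpha>"
      using \<sigma> spec[of "\<lambda>i. i < n \<longrightarrow> \<sigma> ! i \<le> i" "length \<alpha>"] unfolding a_seqs_iff split by auto
    then have "\<alpha> \<noteq> []" using assms by auto
    define j where "j = Max (set \<alpha>)"
    have "j < m" using \<alpha> \<open>\<alpha> \<noteq> []\<close> by (simp add: j_def)
    have "\<forall>x\<in>set \<beta>. j \<le> x"
      using \<sigma> avoids_120_201_append_max_iff[OF \<open>\<alpha> \<noteq> []\<close>, of m \<beta>] \<alpha> \<beta>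
      unfolding a_seqs_iff split(1) j_def by blast
    \<comment> \<open>The lower bound \<open>j\<close> on \<beta> makes the natural-number
      subtraction exact, so \<beta> is a shifted word.\<close>
    then have "map ((+) j) (map (\<lambda>x. x - j) \<beta>) = \<beta>" by (simp add: map_idI)
    then obtain \<omega> where \<omega>: "\<sigma> = \<alpha> @ m # map ((+) j) \<omega>" using split by metis
    have "m = j + (m - j)" using \<open>j < m\<close> by simp
    from append_max_in_a_seqs_iff[OF \<open>\<alpha> \<noteq> []\<close> \<open>j < m\<close> j_def[symmetric] this, of \<omega> n]
    have "m \<le> length \<alpha> \<and> length \<alpha> < n \<and> \<alpha> \<in> a_seqs (length \<alpha>) j \<and>
        \<omega> \<in> b_words (n - Suc (length \<alpha>)) (m - j)"
      using \<sigma> unfolding \<omega> by blast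
    then have "(Suc (length \<alpha>), j, \<alpha>, \<omega>) \<in> ?D" using \<open>j < m\<close> by auto
    then show "\<sigma> \<in> ?f ` ?D" unfolding \<omega> by (rule rev_image_eqI) simp
  qed
qed

theorem theorem13:
  fixes m n :: nat
  assumes "0 < m" and "m < n"
  shows "a_count n m = (\<Sum>p = m + 1..n. \<Sum>j = 0..m - 1. a_count (p - 1) j * b_count (n - p) (m - j))"
proof -
  have "a_count n m = card (SIGMA p : {m + 1..n}. SIGMA j : {0..m - 1}.
      a_seqs (p - 1) j \<times> b_words (n - p) (m - j))"
    using bij_betw_same_card[OF bij_betw_append_max_a_seqs[OF assms]]
    by (simp add: a_count_eq_card)
  \<comment> \<open>All fibres are finite, so the cardinality of the nested dependent sum is the
    double sum of products.\<close>
  also have "\<dots> = (\<Sum>p = m + 1..n. \<Sum>j = 0..m - 1. a_count (p - 1) j * b_count (n - p) (m - j))"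
    by (simp add: card_SigmaI finite_SigmaI finite_a_seqs finite_b_words
        card_cartesian_product a_count_eq_card b_count_eq_card)
  finally show ?thesis .
qed

end
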